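(* For an arbitrary group $G$, $$L_3(G)=\{x\in G \mid \langle x,x^y\rangle \text{ is nilpotent of class at most } 2 \text{ for all } y\in G\}.$$ In particular, every power of a left $3$-Engel element of $G$ is also a left $3$-Engel element of $G$.
   Context: For elements $a,b$ of a group $G$ put $a^b:=b^{-1}ab$, $[a,{}_0 b]:=a$, $[a,b]=[a,{}_1 b]:=a^{-1}b^{-1}ab$, and $[a,{}_n b]:=[[a,{}_{n-1}b],b]$ for $n>0$. An element $x\in G$ is a left $n$-Engel element if $[g,{}_n x]=1$ for all $g\in G$; $L_n(G)$ denotes the set of all left $n$-Engel elements of $G$. *)

theory Defs
  imports "HOL-Algebra.Algebra"
begin

definition conj_by :: "('a, 'b) monoid_scheme \<Rightarrow> 'a \<Rightarrow> 'a \<Rightarrow> 'a" where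
  "conj_by G a b = inv\<^bsub>G\<^esub> b \<otimes>\<^bsub>G\<^esub> a \<otimes>\<^bsub>G\<^esub> b"

text \<open>The convention \<open>[a, b] = a\<^sup>-\<^sup>1 b\<^sup>-\<^sup>1 a b\<close>; the library's \<open>derived_set\<close> uses
  \<open>a b a\<^sup>-\<^sup>1 b\<^sup>-\<^sup>1\<close> instead.\<close>

definition commutator :: "('a, 'b) monoid_scheme \<Rightarrow> 'a \<Rightarrow> 'a \<Rightarrow> 'a" where
  "commutator G a b = inv\<^bsub>G\<^esub> a \<otimes>\<^bsub>G\<^esub> inv\<^bsub>G\<^esub> b \<otimes>\<^bsub>G\<^esub> a \<otimes>\<^bsub>G\<^esub> b"

primrec engel_commutator :: "('a, 'b) monoid_scheme \<Rightarrow> nat \<Rightarrow> 'a \<Rightarrow> 'a \<Rightarrow> 'a" where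
  "engel_commutator G 0 a b = a"
| "engel_commutator G (Suc n) a b = commutator G (engel_commutator G n a b) b"

definition left_engel_elements :: "('a, 'b) monoid_scheme \<Rightarrow> nat \<Rightarrow> 'a set" where
  "left_engel_elements G n =
     {x \<in> carrier G. \<forall>g \<in> carrier G. engel_commutator G n g x = \<one>\<^bsub>G\<^esub>}"

text \<open>Indexing is shifted by one from the customary \<open>\<gamma>\<^sub>1(G) = G\<close>: the \<open>n\<close>-th term here
  is \<open>\<gamma>\<close> with index \<open>n + 1\<close>, so that class at most \<open>c\<close> means that term \<open>c\<close> is trivial.\<close>

primrec lower_central_series :: "('a, 'b) monoid_scheme \<Rightarrow> nat \<Rightarrow> 'a set" where
  "lower_central_series G 0 = carrier G"
| "lower_central_series G (Suc n) =
     generate G {commutator G a b | a b. a \<in> lower_central_series G n \<and> b \<in> carrier G}"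

definition nilpotent :: "('a, 'b) monoid_scheme \<Rightarrow> bool" where
  "nilpotent G \<longleftrightarrow> (\<exists>c. lower_central_series G c = {\<one>\<^bsub>G\<^esub>})"

text \<open>Only meaningful for nilpotent groups, as \<open>LEAST\<close> is unspecified otherwise.\<close>

definition nilpotency_class :: "('a, 'b) monoid_scheme \<Rightarrow> nat" where
  "nilpotency_class G = (LEAST c. lower_central_series G c = {\<one>\<^bsub>G\<^esub>})"

end

theory Submission
  imports Defs
begin

text \<open>
  Write \<open>y = x\<^sup>g\<close>. Then \<open>[g, x] = y\<^sup>-\<^sup>1 x\<close>, and \<open>[g, x, x]\<close> is the conjugate by \<open>x\<close> of
  \<open>(x\<^sup>-\<^sup>1 u)\<^sup>-\<^sup>1\<close>, where \<open>u = y x y\<^sup>-\<^sup>1\<close>. So \<open>[g, x, x, x] = 1\<close> says that \<open>x\<close> commutes with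
  \<open>x\<^sup>-\<^sup>1 u\<close>, hence with \<open>u\<close>; conjugating by \<open>y\<close>, this becomes the statement that \<open>x\<close> commutes
  with \<open>x\<^sup>y\<close> (\<open>engel_commutator_3_eq_one_iff\<close>).

  The left 3-Engel condition on \<open>x\<close> thus says that \<open>x\<close> commutes with \<open>x\<^sup>y\<close> for every conjugate
  \<open>y = x\<^sup>g\<close> of \<open>x\<close>. The condition for \<open>g\<^sup>-\<^sup>1\<close>, conjugated by \<open>g\<close>, has the roles of \<open>x\<close> and \<open>y\<close>
  exchanged: \<open>y\<close> commutes with \<open>y\<^sup>x\<close>. Since \<open>[x, y]\<close> is both \<open>x\<^sup>-\<^sup>1 x\<^sup>y\<close> and the inverse of
  \<open>y\<^sup>-\<^sup>1 y\<^sup>x\<close>, the two statements together say that \<open>[x, y]\<close> commutes with \<open>x\<close> and with \<open>y\<close>,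
  and this is exactly the condition for \<open>\<langle>x, y\<rangle>\<close> to have class at most 2
  (\<open>generate_pair_class_2_iff\<close>).

  The assertion on powers then follows because \<open>\<langle>x\<^sup>k, (x\<^sup>k)\<^sup>g\<rangle>\<close> is a subgroup of
  \<open>\<langle>x, x\<^sup>g\<rangle>\<close>, and class at most 2 passes to subgroups.
\<close>

section \<open>Conjugates, commutators and commuting elements\<close>

context group
begin

text \<open>Together with associativity and the rule for the inverse of a product, these two cancellation
  laws bring a group word, bracketed to the right, into freely reduced form.\<close>

lemma inv_mult_cancel_left:
  assumes "a \<in> carrier G" "b \<in> carrier G"
  shows "inv a \<otimes> (a \<otimes> b) = b" "a \<otimes> (inv a \<otimes> b) = b"
  using assms by (simp_all flip: m_assoc)

lemmas word_simps = m_assoc inv_mult_group inv_mult_cancel_left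

lemma conj_by_closed [simp]:
  "a \<in> carrier G \<Longrightarrow> g \<in> carrier G \<Longrightarrow> conj_by G a g \<in> carrier G"
  by (simp add: conj_by_def)

lemma commutator_closed [simp]:
  "a \<in> carrier G \<Longrightarrow> b \<in> carrier G \<Longrightarrow> commutator G a b \<in> carrier G"
  by (simp add: commutator_def)

lemma conj_by_mult:
  assumes "a \<in> carrier G" "b \<in> carrier G" "g \<in> carrier G"
  shows "conj_by G (a \<otimes> b) g = conj_by G a g \<otimes> conj_by G b g"
  using assms by (simp add: conj_by_def word_simps)

lemma conj_by_conj_by:
  assumes "a \<in> carrier G" "g \<in> carrier G" "h \<in> carrier G"
  shows "conj_by G (conj_by G a g) h = conj_by G a (g \<otimes> h)"
  using assms by (simp add: conj_by_def word_simps)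

lemma conj_by_one [simp]: "a \<in> carrier G \<Longrightarrow> conj_by G a \<one> = a"
  by (simp add: conj_by_def)

lemma conj_by_eq_iff:
  assumes "a \<in> carrier G" "b \<in> carrier G" "g \<in> carrier G"
  shows "conj_by G a g = conj_by G b g \<longleftrightarrow> a = b"
  using assms by (simp add: conj_by_def)

lemma conj_by_commute_iff:
  assumes "a \<in> carrier G" "b \<in> carrier G" "g \<in> carrier G"
  shows "conj_by G a g \<otimes> conj_by G b g = conj_by G b g \<otimes> conj_by G a g \<longleftrightarrow> a \<otimes> b = b \<otimes> a"
  using assms by (simp add: conj_by_eq_iff flip: conj_by_mult)

lemma commutator_eq_one_iff:
  assumes "a \<in> carrier G" "b \<in> carrier G"
  shows "commutator G a b = \<one> \<longleftrightarrow> a \<otimes> b = b \<otimes> a"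
proof -
  have "commutator G a b = inv (b \<otimes> a) \<otimes> (a \<otimes> b)"
    using assms by (simp add: commutator_def word_simps)
  then show ?thesis
    using assms inv_solve_left'[of \<one> "b \<otimes> a" "a \<otimes> b"] by auto
qed

lemma mult_commute_iff:
  assumes "a \<in> carrier G" "b \<in> carrier G" "c \<in> carrier G" "a \<otimes> b = b \<otimes> a"
  shows "a \<otimes> (b \<otimes> c) = (b \<otimes> c) \<otimes> a \<longleftrightarrow> a \<otimes> c = c \<otimes> a"
proof -
  have "a \<otimes> (b \<otimes> c) = b \<otimes> (a \<otimes> c)"
    using assms by (simp flip: m_assoc)
  then show ?thesis
    using assms by (simp add: m_assoc)
qed

lemma inv_commute_iff:
  assumes "a \<in> carrier G" "b \<in> carrier G"
  shows "a \<otimes> inv b = inv b \<otimes> a \<longleftrightarrow> a \<otimes> b = b \<otimes> a"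
proof
  assume "a \<otimes> inv b = inv b \<otimes> a"
  then have "b \<otimes> (a \<otimes> inv b) \<otimes> b = b \<otimes> (inv b \<otimes> a) \<otimes> b" by simp
  then show "a \<otimes> b = b \<otimes> a" using assms by (simp add: word_simps)
next
  assume "a \<otimes> b = b \<otimes> a"
  then have "inv b \<otimes> (a \<otimes> b) \<otimes> inv b = inv b \<otimes> (b \<otimes> a) \<otimes> inv b" by simp
  then show "a \<otimes> inv b = inv b \<otimes> a" using assms by (simp add: word_simps)
qed

lemma subgroup_centralizer:
  assumes "c \<in> carrier G"
  shows "subgroup {h \<in> carrier G. c \<otimes> h = h \<otimes> c} G"
proof (rule subgroupI)
  fix a b assume "a \<in> {h \<in> carrier G. c \<otimes> h = h \<otimes> c}" "b \<in> {h \<in> carrier G. c \<otimes> h = h \<otimes> c}"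
  then show "a \<otimes> b \<in> {h \<in> carrier G. c \<otimes> h = h \<otimes> c}"
    using assms by (simp add: mult_commute_iff)
next
  show "{h \<in> carrier G. c \<otimes> h = h \<otimes> c} \<noteq> {}" using assms by blast
qed (use assms in \<open>simp_all add: inv_commute_iff\<close>)

lemma generate_commute:
  assumes "S \<subseteq> carrier G" "c \<in> carrier G" "\<And>s. s \<in> S \<Longrightarrow> c \<otimes> s = s \<otimes> c" "h \<in> generate G S"
  shows "c \<otimes> h = h \<otimes> c"
proof -
  have "S \<subseteq> {h \<in> carrier G. c \<otimes> h = h \<otimes> c}" using assms(1,3) by blast
  then have "generate G S \<subseteq> {h \<in> carrier G. c \<otimes> h = h \<otimes> c}"
    using subgroup_centralizer[OF assms(2)] by (rule generate_subgroup_incl)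
  then show ?thesis using assms(4) by blast
qed

section \<open>Groups of class at most 2\<close>

lemma generate_trivial_commutators:
  assumes "\<one> \<in> A" "\<And>a b. a \<in> A \<Longrightarrow> b \<in> carrier G \<Longrightarrow> commutator G a b = \<one>"
  shows "generate G {commutator G a b | a b. a \<in> A \<and> b \<in> carrier G} = {\<one>}"
proof -
  have "{commutator G a b | a b. a \<in> A \<and> b \<in> carrier G} = {\<one>}" (is "?S = _")
  proof
    show "?S \<subseteq> {\<one>}" using assms(2) by auto
    have "commutator G \<one> \<one> \<in> ?S" using assms(1) by blast
    then show "{\<one>} \<subseteq> ?S" using assms by simp
  qed
  then show ?thesis by (simp only: generate_one)
qed

text \<open>A series that reaches the trivial group stays there; so the class, the least index of a
  trivial term, is at most \<open>c\<close> as soon as the term with index \<open>c\<close> is trivial, and conversely.\<close>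

lemma lower_central_series_Suc_trivial:
  assumes "lower_central_series G n = {\<one>}"
  shows "lower_central_series G (Suc n) = {\<one>}"
  unfolding lower_central_series.simps assms
  by (rule generate_trivial_commutators) (auto simp: commutator_eq_one_iff)

lemma nilpotency_class_le_iff:
  "nilpotent G \<and> nilpotency_class G \<le> c \<longleftrightarrow> lower_central_series G c = {\<one>}"
proof
  assume *: "nilpotent G \<and> nilpotency_class G \<le> c"
  then have base: "lower_central_series G (nilpotency_class G) = {\<one>}"
    unfolding nilpotent_def nilpotency_class_def by (meson LeastI_ex)
  show "lower_central_series G c = {\<one>}"
    using conjunct2[OF *] by (induction rule: dec_induct) (fact base, rule lower_central_series_Suc_trivial)
next
  assume "lower_central_series G c = {\<one>}"
  then show "nilpotent G \<and> nilpotency_class G \<le> c"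
    unfolding nilpotent_def nilpotency_class_def by (meson Least_le)
qed

text \<open>Centrality is stated element by element, without the lower central series, so that it can
  be compared between a subgroup and the ambient group.\<close>

lemma lower_central_series_2_trivial_iff:
  "lower_central_series G 2 = {\<one>} \<longleftrightarrow>
     (\<forall>a\<in>carrier G. \<forall>b\<in>carrier G. \<forall>c\<in>carrier G. commutator G a b \<otimes> c = c \<otimes> commutator G a b)"
  (is "_ \<longleftrightarrow> ?central")
proof
  assume trivial: "lower_central_series G 2 = {\<one>}"
  show ?central
  proof (intro ballI)
    fix a b c assume abc: "a \<in> carrier G" "b \<in> carrier G" "c \<in> carrier G"
    then have "commutator G a b \<in> lower_central_series G 1"
      by (auto intro: generate.incl)
    then have "commutator G (commutator G a b) c \<in> lower_central_series G 2"
      using abc by (auto simp: numeral_2_eq_2 intro!: generate.incl)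
    then show "commutator G a b \<otimes> c = c \<otimes> commutator G a b"
      using trivial abc by (simp add: commutator_eq_one_iff)
  qed
next
  assume central: ?central
  let ?S = "{commutator G a b | a b. a \<in> carrier G \<and> b \<in> carrier G}"
  have S: "?S \<subseteq> carrier G" by auto
  have "commutator G h c = \<one>" if "h \<in> generate G ?S" "c \<in> carrier G" for h c
  proof -
    have "c \<otimes> h = h \<otimes> c"
    proof (rule generate_commute[OF S])
      fix s assume "s \<in> ?S"
      then obtain a b where "s = commutator G a b" "a \<in> carrier G" "b \<in> carrier G" by blast
      then show "c \<otimes> s = s \<otimes> c" using central that(2) by metis
    qed (use that in simp_all)
    then show ?thesis
      using that generate_in_carrier[OF S that(1)] by (simp add: commutator_eq_one_iff)
  qed
  with generate.one[of G ?S] show "lower_central_series G 2 = {\<one>}"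
    unfolding numeral_2_eq_2 lower_central_series.simps by (rule generate_trivial_commutators)
qed

text \<open>If \<open>Z\<close> is central, then \<open>[a a', b] = [a, b] [a', b]\<close> and \<open>[a\<^sup>-\<^sup>1, b] = [a, b]\<^sup>-\<^sup>1\<close> for
  commutators in \<open>Z\<close>: in \<open>a b = b a [a, b]\<close> the last factor can be moved past everything else.\<close>

lemma subgroup_commutator_central:
  assumes Z: "subgroup Z G"
    and central: "\<And>z a. z \<in> Z \<Longrightarrow> a \<in> H \<Longrightarrow> z \<otimes> a = a \<otimes> z"
    and H: "subgroup H G" and b: "b \<in> H"
  shows "subgroup {a \<in> H. commutator G a b \<in> Z} G"
proof -
  interpret H: subgroup H G by (rule H)
  interpret Z: subgroup Z G by (rule Z)
  have comm: "a \<otimes> b = b \<otimes> a \<otimes> commutator G a b" if "a \<in> H" for a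
    using that b by (simp add: commutator_def word_simps)
  \<comment> \<open>Commutators are recognised through the equation \<open>a b = b a z\<close>, which determines \<open>z\<close>.\<close>
  have commI: "commutator G a b = z" if "a \<otimes> b = b \<otimes> a \<otimes> z" "a \<in> H" "z \<in> Z" for a z
    using that b comm[of a] by simp
  show ?thesis
  proof (rule subgroupI)
    have "commutator G \<one> b = \<one>" using b by (simp add: commutator_def)
    then have "\<one> \<in> {a \<in> H. commutator G a b \<in> Z}" by simp
    then show "{a \<in> H. commutator G a b \<in> Z} \<noteq> {}" by blast
  next
    fix a assume a: "a \<in> {a \<in> H. commutator G a b \<in> Z}"
    have "inv a \<otimes> b = b \<otimes> inv a \<otimes> inv (commutator G a b)"
    proof -
      have "b \<otimes> inv a \<otimes> inv (commutator G a b) = b \<otimes> (inv (commutator G a b) \<otimes> inv a)"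
        using central[of "inv (commutator G a b)" "inv a"] a b by (simp add: m_assoc)
      also have "\<dots> = inv a \<otimes> b"
        using a b by (simp add: commutator_def word_simps)
      finally show ?thesis by simp
    qed
    then have "commutator G (inv a) b = inv (commutator G a b)"
      using a by (intro commI) auto
    then show "inv a \<in> {a \<in> H. commutator G a b \<in> Z}"
      using a by simp
  next
    fix a a' assume a: "a \<in> {a \<in> H. commutator G a b \<in> Z}" "a' \<in> {a \<in> H. commutator G a b \<in> Z}"
    have "a \<otimes> a' \<otimes> b = a \<otimes> b \<otimes> a' \<otimes> commutator G a' b"
      using a b comm[of a'] by (simp add: m_assoc)
    also have "\<dots> = b \<otimes> a \<otimes> (commutator G a b \<otimes> a') \<otimes> commutator G a' b"
      using a b comm[of a] by (simp add: m_assoc)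
    also have "\<dots> = b \<otimes> (a \<otimes> a') \<otimes> (commutator G a b \<otimes> commutator G a' b)"
      using a b central[of "commutator G a b" a'] by (simp add: m_assoc)
    finally have "commutator G (a \<otimes> a') b = commutator G a b \<otimes> commutator G a' b"
      using a by (intro commI) auto
    then show "a \<otimes> a' \<in> {a \<in> H. commutator G a b \<in> Z}"
      using a by simp
  qed auto
qed

lemma commutator_subgroup:
  assumes "subgroup H G" "a \<in> H" "b \<in> H"
  shows "commutator (G\<lparr>carrier := H\<rparr>) a b = commutator G a b"
  using assms by (simp add: commutator_def m_inv_consistent)

lemma subgroup_class_2_iff:
  assumes H: "subgroup H G"
  shows "lower_central_series (G\<lparr>carrier := H\<rparr>) 2 = {\<one>} \<longleftrightarrow>
    (\<forall>a\<in>H. \<forall>b\<in>H. \<forall>c\<in>H. commutator G a b \<otimes> c = c \<otimes> commutator G a b)"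
proof -
  interpret H: group "G\<lparr>carrier := H\<rparr>" by (rule subgroup_imp_group[OF H])
  show ?thesis
    using H.lower_central_series_2_trivial_iff by (simp add: commutator_subgroup[OF H])
qed

lemma commutator_inv:
  assumes "a \<in> carrier G" "b \<in> carrier G"
  shows "inv (commutator G a b) = commutator G b a"
  using assms by (simp add: commutator_def word_simps)

text \<open>If \<open>[x, y]\<close> commutes with the generators, it lies in the centre of \<open>\<langle>x, y\<rangle>\<close>. Modulo this centre
  the generators commute, so the quotient is abelian and all commutators are central. The proof
  works with commutators modulo a central subgroup instead of forming the quotient.\<close>

lemma generate_pair_class_2_iff:
  assumes x: "x \<in> carrier G" and y: "y \<in> carrier G"
  shows "lower_central_series (G\<lparr>carrier := generate G {x, y}\<rparr>) 2 = {\<one>} \<longleftrightarrow>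
    x \<otimes> commutator G x y = commutator G x y \<otimes> x \<and> y \<otimes> commutator G x y = commutator G x y \<otimes> y"
    (is "?trivial \<longleftrightarrow> ?commute")
proof -
  let ?H = "generate G {x, y}"
  have H: "subgroup ?H G"
    using x y by (intro generate_is_subgroup) auto
  have xH: "x \<in> ?H" and yH: "y \<in> ?H"
    by (simp_all add: generate.incl)
  show ?thesis
  proof
    assume ?trivial
    then show ?commute
      unfolding subgroup_class_2_iff[OF H] using xH yH by metis
  next
    assume commute: ?commute
    \<comment> \<open>Taking the centralizer in the whole group makes \<open>Z\<close> an intersection of centralizers of
      single elements, hence a subgroup.\<close>
    define Z where "Z = (\<Inter>h\<in>?H. {z \<in> carrier G. h \<otimes> z = z \<otimes> h})"
    have carrier: "h \<in> carrier G" if "h \<in> ?H" for h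
      using subgroup.mem_carrier[OF H that] .
    have Z: "subgroup Z G"
      unfolding Z_def using xH carrier
      by (intro subgroups_Inter) (auto intro: subgroup_centralizer)
    have central: "z \<otimes> h = h \<otimes> z" if "z \<in> Z" "h \<in> ?H" for z h
      using that unfolding Z_def by auto
    have "commutator G x y \<otimes> h = h \<otimes> commutator G x y" if "h \<in> ?H" for h
      by (rule generate_commute[of "{x, y}"]) (use that x y commute in auto)
    then have xyZ: "commutator G x y \<in> Z"
      unfolding Z_def using x y by simp
    then have yxZ: "commutator G y x \<in> Z"
      using subgroup.m_inv_closed[OF Z xyZ] x y by (simp add: commutator_inv)
    have oneZ: "commutator G a a \<in> Z" if "a \<in> carrier G" for a
      using that subgroup.one_closed[OF Z] commutator_eq_one_iff[of a a] by simp
    \<comment> \<open>For \<open>b\<close> in the group, the elements commuting with \<open>b\<close> modulo \<open>Z\<close> form a subgroup, so it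
      is enough to test the generators. Applied with \<open>b\<close> a generator and then, after swapping
      the two arguments, with \<open>b\<close> arbitrary, this brings every commutator into \<open>Z\<close>.\<close>
    have reduce: "commutator G a b \<in> Z"
      if "b \<in> ?H" "commutator G x b \<in> Z" "commutator G y b \<in> Z" "a \<in> ?H" for a b
    proof -
      have "?H \<subseteq> {a \<in> ?H. commutator G a b \<in> Z}"
        using that xH yH
        by (intro generate_subgroup_incl subgroup_commutator_central[OF Z central H]) auto
      then show ?thesis using that(4) by blast
    qed
    have "commutator G a b \<in> Z" if "a \<in> ?H" "b \<in> ?H" for a b
    proof -
      have "commutator G b x \<in> Z"
        by (rule reduce[OF xH oneZ[OF x] yxZ that(2)])
      then have xb: "commutator G x b \<in> Z"
        using subgroup.m_inv_closed[OF Z] commutator_inv[OF carrier[OF that(2)] x] by metis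
      have "commutator G b y \<in> Z"
        by (rule reduce[OF yH xyZ oneZ[OF y] that(2)])
      then have yb: "commutator G y b \<in> Z"
        using subgroup.m_inv_closed[OF Z] commutator_inv[OF carrier[OF that(2)] y] by metis
      show ?thesis by (rule reduce[OF that(2) xb yb that(1)])
    qed
    then show ?trivial
      unfolding subgroup_class_2_iff[OF H] using central by blast
  qed
qed

section \<open>Left 3-Engel elements\<close>

text \<open>Every triple Engel commutator ending in \<open>x\<close> only depends on \<open>g\<close> through the conjugate
  \<open>y = x\<^sup>g\<close>. The double one is \<open>((x\<^sup>-\<^sup>1 u)\<^sup>-\<^sup>1)\<^sup>x\<close> with \<open>u = y x y\<^sup>-\<^sup>1\<close>, and commuting with \<open>x\<close> is
  unchanged by conjugation by \<open>x\<close>, by inversion, and by removing the factor \<open>x\<^sup>-\<^sup>1\<close>.\<close>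

lemma engel_commutator_3_eq_one_iff:
  assumes x: "x \<in> carrier G" and g: "g \<in> carrier G"
  defines "y \<equiv> conj_by G x g"
  shows "engel_commutator G 3 g x = \<one> \<longleftrightarrow> x \<otimes> conj_by G x y = conj_by G x y \<otimes> x"
proof -
  have y: "y \<in> carrier G" using x g by (simp add: y_def)
  let ?u = "conj_by G x (inv y)"
  let ?e = "engel_commutator G 2 g x"
  have u: "?u \<in> carrier G" using x y by simp
  have "commutator G g x = inv y \<otimes> x"
    using x g by (simp add: y_def commutator_def conj_by_def word_simps)
  then have e: "?e = conj_by G (inv (inv x \<otimes> ?u)) x"
    using x y by (simp add: numeral_2_eq_2 commutator_def conj_by_def word_simps)
  have "engel_commutator G 3 g x = \<one> \<longleftrightarrow> x \<otimes> ?e = ?e \<otimes> x"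
  proof -
    have "engel_commutator G 3 g x = commutator G ?e x"
      by (simp add: numeral_3_eq_3 numeral_2_eq_2)
    moreover have "?e \<in> carrier G" unfolding e using x u by simp
    ultimately show ?thesis using x commutator_eq_one_iff[of ?e x] by metis
  qed
  also have "\<dots> \<longleftrightarrow> conj_by G x x \<otimes> ?e = ?e \<otimes> conj_by G x x"
    using x by (simp add: conj_by_def)
  also have "\<dots> \<longleftrightarrow> x \<otimes> inv (inv x \<otimes> ?u) = inv (inv x \<otimes> ?u) \<otimes> x"
    unfolding e using x u by (intro conj_by_commute_iff) auto
  also have "\<dots> \<longleftrightarrow> x \<otimes> (inv x \<otimes> ?u) = (inv x \<otimes> ?u) \<otimes> x"
    using x u by (intro inv_commute_iff) auto
  also have "\<dots> \<longleftrightarrow> x \<otimes> ?u = ?u \<otimes> x"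
    using x u by (intro mult_commute_iff) auto
  also have "\<dots> \<longleftrightarrow> conj_by G x y \<otimes> x = x \<otimes> conj_by G x y"
  proof -
    have "conj_by G ?u y = x"
      using x y by (simp add: conj_by_conj_by)
    then show ?thesis
      using conj_by_commute_iff[OF x u y] by simp
  qed
  finally show ?thesis by (simp only: eq_commute)
qed

text \<open>The commutator is \<open>x\<^sup>-\<^sup>1 x\<^sup>y\<close>, and its inverse is \<open>y\<^sup>-\<^sup>1 y\<^sup>x\<close>.\<close>

lemma commute_commutator_iff:
  assumes "x \<in> carrier G" "y \<in> carrier G"
  shows "x \<otimes> commutator G x y = commutator G x y \<otimes> x \<longleftrightarrow> x \<otimes> conj_by G x y = conj_by G x y \<otimes> x"
    and "y \<otimes> commutator G x y = commutator G x y \<otimes> y \<longleftrightarrow> y \<otimes> conj_by G y x = conj_by G y x \<otimes> y"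
proof -
  have "commutator G x y = inv x \<otimes> conj_by G x y"
    using assms by (simp add: commutator_def conj_by_def word_simps)
  then show "x \<otimes> commutator G x y = commutator G x y \<otimes> x \<longleftrightarrow> x \<otimes> conj_by G x y = conj_by G x y \<otimes> x"
    using assms mult_commute_iff[of x "inv x" "conj_by G x y"] by simp
  have "inv (commutator G x y) = inv y \<otimes> conj_by G y x"
    using assms by (simp add: commutator_def conj_by_def word_simps)
  then show "y \<otimes> commutator G x y = commutator G x y \<otimes> y \<longleftrightarrow> y \<otimes> conj_by G y x = conj_by G y x \<otimes> y"
    using assms mult_commute_iff[of y "inv y" "conj_by G y x"] inv_commute_iff[of y "commutator G x y"]
    by simp
qed

lemma left_engel_elements_subset: "left_engel_elements G n \<subseteq> carrier G"
  by (auto simp: left_engel_elements_def)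

lemma left_3_engel_iff_commute:
  assumes "x \<in> carrier G"
  shows "x \<in> left_engel_elements G 3 \<longleftrightarrow>
    (\<forall>g\<in>carrier G. x \<otimes> conj_by G x (conj_by G x g) = conj_by G x (conj_by G x g) \<otimes> x)"
  using assms by (simp add: left_engel_elements_def engel_commutator_3_eq_one_iff)

text \<open>A single commutation \<open>x x\<^sup>y = x\<^sup>y x\<close> with \<open>y = x\<^sup>g\<close> only gives that \<open>[x, y]\<close> commutes with \<open>x\<close>.
  That it commutes with \<open>y\<close> comes from the condition for \<open>g\<^sup>-\<^sup>1\<close>, conjugated by \<open>g\<close>.\<close>

lemma left_3_engel_iff_class_2:
  assumes x: "x \<in> carrier G"
  shows "x \<in> left_engel_elements G 3 \<longleftrightarrow>
    (\<forall>g\<in>carrier G. lower_central_series (G\<lparr>carrier := generate G {x, conj_by G x g}\<rparr>) 2 = {\<one>})"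
proof
  assume *: "x \<in> left_engel_elements G 3"
  show "\<forall>g\<in>carrier G. lower_central_series (G\<lparr>carrier := generate G {x, conj_by G x g}\<rparr>) 2 = {\<one>}"
  proof
    fix g assume g: "g \<in> carrier G"
    let ?y = "conj_by G x g" and ?z = "conj_by G x (inv g)"
    have "x \<otimes> conj_by G x ?z = conj_by G x ?z \<otimes> x"
      using * g x by (simp add: left_3_engel_iff_commute)
    then have "?y \<otimes> conj_by G (conj_by G x ?z) g = conj_by G (conj_by G x ?z) g \<otimes> ?y"
      using g x by (simp add: conj_by_commute_iff)
    moreover have "conj_by G (conj_by G x ?z) g = conj_by G ?y x"
      using g x by (simp add: conj_by_def word_simps)
    ultimately have "?y \<otimes> conj_by G ?y x = conj_by G ?y x \<otimes> ?y" by simp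
    moreover have "x \<otimes> conj_by G x ?y = conj_by G x ?y \<otimes> x"
      using * g x by (simp add: left_3_engel_iff_commute)
    ultimately show "lower_central_series (G\<lparr>carrier := generate G {x, ?y}\<rparr>) 2 = {\<one>}"
      using generate_pair_class_2_iff[of x ?y] commute_commutator_iff[of x ?y] g x by simp
  qed
next
  assume *: "\<forall>g\<in>carrier G. lower_central_series (G\<lparr>carrier := generate G {x, conj_by G x g}\<rparr>) 2 = {\<one>}"
  have "x \<otimes> conj_by G x (conj_by G x g) = conj_by G x (conj_by G x g) \<otimes> x" if "g \<in> carrier G" for g
    using * that x generate_pair_class_2_iff[of x "conj_by G x g"]
      commute_commutator_iff(1)[of x "conj_by G x g"] by simp
  then show "x \<in> left_engel_elements G 3"
    using x by (simp add: left_3_engel_iff_commute)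
qed

lemma conj_by_int_pow:
  assumes "a \<in> carrier G" "g \<in> carrier G"
  shows "conj_by G (a [^] (k :: int)) g = conj_by G a g [^] k"
proof -
  have "(\<lambda>a. conj_by G a g) \<in> hom G G"
    using assms by (simp add: hom_def conj_by_mult)
  then show ?thesis
    using assms hom_int_pow[of "\<lambda>a. conj_by G a g" G G] by (simp add: is_group)
qed

text \<open>Both generators of \<open>\<langle>x\<^sup>k, (x\<^sup>k)\<^sup>g\<rangle>\<close> lie in \<open>\<langle>x, x\<^sup>g\<rangle>\<close>, since \<open>(x\<^sup>k)\<^sup>g = (x\<^sup>g)\<^sup>k\<close>.\<close>

lemma left_3_engel_int_pow:
  assumes "x \<in> left_engel_elements G 3"
  shows "x [^] (k :: int) \<in> left_engel_elements G 3"
proof -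
  have x: "x \<in> carrier G" using assms by (simp add: left_engel_elements_def)
  have "lower_central_series (G\<lparr>carrier := generate G {x [^] k, conj_by G (x [^] k) g}\<rparr>) 2 = {\<one>}"
    if g: "g \<in> carrier G" for g
  proof -
    let ?H = "generate G {x, conj_by G x g}" and ?K = "generate G {x [^] k, conj_by G (x [^] k) g}"
    have H: "subgroup ?H G" and K: "subgroup ?K G"
      using x g by (simp_all add: generate_is_subgroup)
    have "x [^] k \<in> ?H" "conj_by G (x [^] k) g \<in> ?H"
      using x g by (auto simp: conj_by_int_pow generate.incl intro!: subgroup_int_pow_closed[OF H])
    then have "?K \<subseteq> ?H"
      by (intro generate_subgroup_incl[OF _ H]) simp
    moreover have "lower_central_series (G\<lparr>carrier := ?H\<rparr>) 2 = {\<one>}"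
      using assms x g by (simp add: left_3_engel_iff_class_2)
    ultimately show ?thesis
      unfolding subgroup_class_2_iff[OF H] subgroup_class_2_iff[OF K] by blast
  qed
  then show ?thesis using x by (simp add: left_3_engel_iff_class_2)
qed

end

theorem corollary2p2:
  fixes G :: "('a, 'b) monoid_scheme"
  assumes "group G"
  shows "left_engel_elements G 3 =
           {x \<in> carrier G. \<forall>y \<in> carrier G.
              nilpotent (G\<lparr>carrier := generate G {x, conj_by G x y}\<rparr>) \<and>
              nilpotency_class (G\<lparr>carrier := generate G {x, conj_by G x y}\<rparr>) \<le> 2} \<and>
         (\<forall>x \<in> left_engel_elements G 3. \<forall>k :: int. x [^]\<^bsub>G\<^esub> k \<in> left_engel_elements G 3)"
proof -
  interpret group G by (rule assms)
  have class_2: "nilpotent (G\<lparr>carrier := generate G {x, conj_by G x y}\<rparr>) \<and>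
      nilpotency_class (G\<lparr>carrier := generate G {x, conj_by G x y}\<rparr>) \<le> 2 \<longleftrightarrow>
      lower_central_series (G\<lparr>carrier := generate G {x, conj_by G x y}\<rparr>) 2 = {\<one>\<^bsub>G\<^esub>}"
    if "x \<in> carrier G" "y \<in> carrier G" for x y
  proof -
    have "subgroup (generate G {x, conj_by G x y}) G"
      using that by (simp add: generate_is_subgroup)
    from group.nilpotency_class_le_iff[OF subgroup_imp_group[OF this]] show ?thesis by simp
  qed
  have "left_engel_elements G 3 =
           {x \<in> carrier G. \<forall>y \<in> carrier G.
              nilpotent (G\<lparr>carrier := generate G {x, conj_by G x y}\<rparr>) \<and>
              nilpotency_class (G\<lparr>carrier := generate G {x, conj_by G x y}\<rparr>) \<le> 2}"
    (is "_ = {x \<in> carrier G. ?P x}")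
  proof (rule Set.set_eqI)
    fix x
    have "x \<in> left_engel_elements G 3 \<longleftrightarrow> ?P x" if "x \<in> carrier G"
      unfolding left_3_engel_iff_class_2[OF that] by (rule ball_cong[OF refl], rule sym) (rule class_2[OF that])
    then show "x \<in> left_engel_elements G 3 \<longleftrightarrow> x \<in> {x \<in> carrier G. ?P x}"
      using left_engel_elements_subset[of 3] by (simp only: mem_Collect_eq) blast
  qed
  then show ?thesis using left_3_engel_int_pow by blast
qed

end
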